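(* Let $R$ be a semiprime ring. The following conditions are equivalent: (1) $R$ is left Goldie; (2) $R$ is regular left fusible and has finite left Goldie dimension.
   Context: All rings are associative with unity (not necessarily commutative). For $A\subseteq R$ nonempty, $\mathrm{lann}_R(A)=\{r\in R\mid rA=0\}$. An element $a\in R$ is a left zero-divisor if $\mathrm{lann}_R(a)\neq 0$ (so there is a nonzero $r$ with $ra=0$); it is left regular if it is not a left zero-divisor, i.e. $\mathrm{lann}_R(a)=0$. An element is regular if it is both left and right regular (right regular: $ar=0$ implies $r=0$). A nonzero element $r\in R$ is left fusible if $r=c+w$ for some left zero-divisor $c$ and some left regular element $w$ of $R$. The ring $R$ is regular left fusible if for every nonzero $r\in R$ there exists a regular element $s\in R$ such that $sr$ is left fusible. Left Goldie dimension means the uniform (Goldie) dimension of the left module ${}_RR$; a ring is left Goldie if it has finite left Goldie dimension and satisfies the ascending chain condition on left annihilators. *)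

theory Defs
  imports "HOL-Algebra.Algebra"
begin

text \<open>
  The zero ideal is semiprime: no nonzero two-sided ideal has square zero, equivalently no nonzero
  two-sided ideal is nilpotent.
\<close>

definition semiprime_ring :: "('a, 'b) ring_scheme \<Rightarrow> bool" where
  "semiprime_ring R \<longleftrightarrow> ring R \<and>
     (\<forall>I. ideal I R \<and> ideal_prod R I I = {\<zero>\<^bsub>R\<^esub>} \<longrightarrow> I = {\<zero>\<^bsub>R\<^esub>})"

definition lann :: "('a, 'b) ring_scheme \<Rightarrow> 'a set \<Rightarrow> 'a set" where
  "lann R A = {r \<in> carrier R. \<forall>a\<in>A. r \<otimes>\<^bsub>R\<^esub> a = \<zero>\<^bsub>R\<^esub>}"

text \<open>Zero counts as a left zero-divisor of every nonzero ring.\<close>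

definition left_zero_divisor :: "('a, 'b) ring_scheme \<Rightarrow> 'a \<Rightarrow> bool" where
  "left_zero_divisor R a \<longleftrightarrow> a \<in> carrier R \<and> lann R {a} \<noteq> {\<zero>\<^bsub>R\<^esub>}"

definition left_regular :: "('a, 'b) ring_scheme \<Rightarrow> 'a \<Rightarrow> bool" where
  "left_regular R a \<longleftrightarrow> a \<in> carrier R \<and> \<not> left_zero_divisor R a"

definition right_regular :: "('a, 'b) ring_scheme \<Rightarrow> 'a \<Rightarrow> bool" where
  "right_regular R a \<longleftrightarrow> a \<in> carrier R \<and>
     (\<forall>r\<in>carrier R. a \<otimes>\<^bsub>R\<^esub> r = \<zero>\<^bsub>R\<^esub> \<longrightarrow> r = \<zero>\<^bsub>R\<^esub>)"

definition regular_element :: "('a, 'b) ring_scheme \<Rightarrow> 'a \<Rightarrow> bool" where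
  "regular_element R a \<longleftrightarrow> left_regular R a \<and> right_regular R a"

definition left_fusible_element :: "('a, 'b) ring_scheme \<Rightarrow> 'a \<Rightarrow> bool" where
  "left_fusible_element R r \<longleftrightarrow> r \<in> carrier R \<and> r \<noteq> \<zero>\<^bsub>R\<^esub> \<and>
     (\<exists>c w. left_zero_divisor R c \<and> left_regular R w \<and> r = c \<oplus>\<^bsub>R\<^esub> w)"

definition regular_left_fusible :: "('a, 'b) ring_scheme \<Rightarrow> bool" where
  "regular_left_fusible R \<longleftrightarrow>
     (\<forall>r\<in>carrier R. r \<noteq> \<zero>\<^bsub>R\<^esub> \<longrightarrow>
        (\<exists>s. regular_element R s \<and> left_fusible_element R (s \<otimes>\<^bsub>R\<^esub> r)))"

text \<open>
  The submodules of the left module R over itself are the left ideals.  The module locales of the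
  library require commutative scalars, so the module notions below are spelled out for left ideals.
\<close>

definition left_ideal :: "'a set \<Rightarrow> ('a, 'b) ring_scheme \<Rightarrow> bool" where
  "left_ideal I R \<longleftrightarrow> additive_subgroup I R \<and>
     (\<forall>r\<in>carrier R. \<forall>a\<in>I. r \<otimes>\<^bsub>R\<^esub> a \<in> I)"

definition essential_left_ideal :: "'a set \<Rightarrow> ('a, 'b) ring_scheme \<Rightarrow> bool" where
  "essential_left_ideal E R \<longleftrightarrow> left_ideal E R \<and>
     (\<forall>J. left_ideal J R \<and> J \<noteq> {\<zero>\<^bsub>R\<^esub>} \<longrightarrow> E \<inter> J \<noteq> {\<zero>\<^bsub>R\<^esub>})"

definition uniform_left_ideal :: "'a set \<Rightarrow> ('a, 'b) ring_scheme \<Rightarrow> bool" where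
  "uniform_left_ideal U R \<longleftrightarrow> left_ideal U R \<and> U \<noteq> {\<zero>\<^bsub>R\<^esub>} \<and>
     (\<forall>J K. left_ideal J R \<and> left_ideal K R \<and> J \<subseteq> U \<and> K \<subseteq> U \<and>
        J \<noteq> {\<zero>\<^bsub>R\<^esub>} \<and> K \<noteq> {\<zero>\<^bsub>R\<^esub>} \<longrightarrow> J \<inter> K \<noteq> {\<zero>\<^bsub>R\<^esub>})"

definition left_ideal_sum :: "('a, 'b) ring_scheme \<Rightarrow> nat \<Rightarrow> (nat \<Rightarrow> 'a set) \<Rightarrow> 'a set" where
  "left_ideal_sum R n U = {finsum R x {..<n} | x. x \<in> (\<Pi> i\<in>{..<n}. U i)}"

definition independent_left_ideals :: "('a, 'b) ring_scheme \<Rightarrow> nat \<Rightarrow> (nat \<Rightarrow> 'a set) \<Rightarrow> bool" where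
  "independent_left_ideals R n U \<longleftrightarrow>
     (\<forall>x \<in> (\<Pi> i\<in>{..<n}. U i). finsum R x {..<n} = \<zero>\<^bsub>R\<^esub> \<longrightarrow> (\<forall>i<n. x i = \<zero>\<^bsub>R\<^esub>))"

text \<open>
  The left Goldie dimension is n if some direct sum of n uniform left ideals is essential in R.
  Here n = 0 occurs exactly for the zero ring.
\<close>

definition has_left_goldie_dim :: "('a, 'b) ring_scheme \<Rightarrow> nat \<Rightarrow> bool" where
  "has_left_goldie_dim R n \<longleftrightarrow>
     (\<exists>U. (\<forall>i<n. uniform_left_ideal (U i) R) \<and> independent_left_ideals R n U \<and>
        essential_left_ideal (left_ideal_sum R n U) R)"

definition finite_left_goldie_dim :: "('a, 'b) ring_scheme \<Rightarrow> bool" where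
  "finite_left_goldie_dim R \<longleftrightarrow> (\<exists>n. has_left_goldie_dim R n)"

definition left_annihilators :: "('a, 'b) ring_scheme \<Rightarrow> 'a set set" where
  "left_annihilators R = {lann R A | A. A \<subseteq> carrier R \<and> A \<noteq> {}}"

definition acc_left_annihilators :: "('a, 'b) ring_scheme \<Rightarrow> bool" where
  "acc_left_annihilators R \<longleftrightarrow>
     (\<forall>L :: nat \<Rightarrow> 'a set. (\<forall>k. L k \<in> left_annihilators R \<and> L k \<subseteq> L (Suc k)) \<longrightarrow>
        (\<exists>N. \<forall>k\<ge>N. L k = L N))"

definition left_goldie :: "('a, 'b) ring_scheme \<Rightarrow> bool" where
  "left_goldie R \<longleftrightarrow> finite_left_goldie_dim R \<and> acc_left_annihilators R"

end

theory Submission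
  imports Defs
begin

text \<open>
  The bridge between the two conditions is left nonsingularity: no nonzero element is annihilated by
  an essential left ideal.

  Suppose that \<open>R\<close> is regular left fusible of finite left Goldie dimension.  If an essential left
  ideal annihilated a nonzero \<open>r\<close>, then one would annihilate \<open>s r = c + w\<close> as well; it meets the
  nonzero annihilator of the zero-divisor \<open>c\<close>, and what lies in both annihilates the left regular
  element \<open>w\<close>.  So \<open>R\<close> is nonsingular (\<open>nonsingular_if_regular_left_fusible\<close>).  In a nonsingular
  ring a left annihilator has no proper essential extension inside another one, so a strictly
  ascending chain of left annihilators would leave room for a new independent left ideal at each
  step, against finite dimension (\<open>acc_left_annihilators_if_nonsingular\<close>).

  Conversely let \<open>R\<close> be semiprime left Goldie and \<open>r \<noteq> 0\<close>.  Then \<open>r\<close> itself is left fusible, so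
  \<open>s = 1\<close> serves in the definition.  The idea is to repair the
  kernel of right multiplication by \<open>r\<close>: starting with \<open>w = r\<close>, add elements to \<open>w\<close>
  until \<open>lann w = 0\<close>, while an element \<open>l\<close> with \<open>l r = 0\<close> and \<open>lann l \<subseteq> lann (r - w)\<close> is built
  alongside.  At the end \<open>w\<close> is left regular.  If \<open>r - w\<close> were no left zero-divisor, then
  \<open>lann l = 0\<close>, and finite dimension would make \<open>l\<close> right regular too
  (\<open>right_regular_if_left_regular\<close>), contradicting \<open>l r = 0\<close>.  So \<open>r = (r - w) + w\<close> is the required
  decomposition.

  One step of the construction needs, for \<open>N = lann w \<noteq> 0\<close>, elements \<open>v\<close> and \<open>u \<in> N\<close> such that
  \<open>R v\<close> avoids \<open>R w\<close>, the annihilators of \<open>v\<close>, of \<open>a = v u\<close> and of \<open>a\<^sup>2\<close> agree, and \<open>a \<noteq> 0\<close>; then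
  \<open>w + v\<close> and \<open>l + a\<close> replace \<open>w\<close> and \<open>l\<close>.  That \<open>R w\<close> leaves room for \<open>v\<close> is
  \<open>principal_misses_right_multiples\<close>, and the equality of annihilators is reached in
  \<open>product_with_stable_lann\<close>.  The annihilator of \<open>w + v\<close> misses \<open>R a \<subseteq> N\<close>, so it is not essential
  in \<open>N\<close>, and finite dimension ends the process.

  Finite dimension enters only through \<open>finite_goldie_dim_rank\<close>: there is a bounded natural-valued
  rank on left ideals that increases strictly along every inclusion that is not essential.
\<close>

section \<open>Left ideals and essential inclusions\<close>

text \<open>
  For left ideals \<open>L\<close> and \<open>M\<close> this says that \<open>L\<close> meets every nonzero left ideal inside \<open>M\<close>; testing
  the principal ones \<open>R x\<close> suffices.
\<close>

definition essential_in :: "('a, 'b) ring_scheme \<Rightarrow> 'a set \<Rightarrow> 'a set \<Rightarrow> bool" where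
  "essential_in R L M \<longleftrightarrow>
     (\<forall>x\<in>M. x \<noteq> \<zero>\<^bsub>R\<^esub> \<longrightarrow>
        (\<exists>r\<in>carrier R. r \<otimes>\<^bsub>R\<^esub> x \<in> L \<and> r \<otimes>\<^bsub>R\<^esub> x \<noteq> \<zero>\<^bsub>R\<^esub>))"

context ring
begin

lemma lann_singleton: "lann R {a} = {r \<in> carrier R. r \<otimes> a = \<zero>}"
  by (auto simp: lann_def)

lemma left_idealI:
  assumes "I \<subseteq> carrier R" "\<zero> \<in> I"
    and "\<And>x y. x \<in> I \<Longrightarrow> y \<in> I \<Longrightarrow> x \<oplus> y \<in> I"
    and mult: "\<And>r x. r \<in> carrier R \<Longrightarrow> x \<in> I \<Longrightarrow> r \<otimes> x \<in> I"
  shows "left_ideal I R"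
proof -
  have "\<ominus> x \<in> I" if "x \<in> I" for x
    using mult[of "\<ominus> \<one>" x] that assms(1) by (auto simp: l_minus)
  then have "subgroup I (add_monoid R)"
    using assms by (intro add.subgroupI) (auto simp: a_inv_def)
  then show ?thesis
    using mult by (simp add: left_ideal_def additive_subgroup_def)
qed

lemma left_idealD:
  assumes "left_ideal I R"
  shows "I \<subseteq> carrier R" "\<zero> \<in> I"
    and "\<And>x. x \<in> I \<Longrightarrow> x \<in> carrier R"
    and "\<And>x y. x \<in> I \<Longrightarrow> y \<in> I \<Longrightarrow> x \<oplus> y \<in> I"
    and "\<And>x. x \<in> I \<Longrightarrow> \<ominus> x \<in> I"
    and "\<And>x y. x \<in> I \<Longrightarrow> y \<in> I \<Longrightarrow> x \<ominus> y \<in> I"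
    and "\<And>r x. r \<in> carrier R \<Longrightarrow> x \<in> I \<Longrightarrow> r \<otimes> x \<in> I"
proof -
  interpret additive_subgroup I R using assms by (simp add: left_ideal_def)
  show "I \<subseteq> carrier R" by (rule a_subset)
  show "\<zero> \<in> I" by (rule zero_closed)
  show "\<And>x. x \<in> I \<Longrightarrow> x \<in> carrier R" by (rule a_Hcarr)
  show "\<And>x y. x \<in> I \<Longrightarrow> y \<in> I \<Longrightarrow> x \<oplus> y \<in> I" by (rule a_closed)
  show "\<And>x. x \<in> I \<Longrightarrow> \<ominus> x \<in> I" by (rule a_inv_closed)
  then show "\<And>x y. x \<in> I \<Longrightarrow> y \<in> I \<Longrightarrow> x \<ominus> y \<in> I"
    unfolding a_minus_def by (intro a_closed)
  show "\<And>r x. r \<in> carrier R \<Longrightarrow> x \<in> I \<Longrightarrow> r \<otimes> x \<in> I"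
    using assms by (simp add: left_ideal_def)
qed

lemma left_ideal_zero: "left_ideal {\<zero>} R"
  by (rule left_idealI) auto

lemma left_ideal_lann: "A \<subseteq> carrier R \<Longrightarrow> left_ideal (lann R A) R"
  by (rule left_idealI) (auto simp: lann_def l_distr m_assoc subset_iff)

lemma left_ideal_right_mult:
  assumes "left_ideal I R" "a \<in> carrier R"
  shows "left_ideal ((\<lambda>x. x \<otimes> a) ` I) R"
proof (rule left_idealI)
  note I = left_idealD[OF assms(1)]
  show "(\<lambda>x. x \<otimes> a) ` I \<subseteq> carrier R" using I(3) assms(2) by auto
  show "\<zero> \<in> (\<lambda>x. x \<otimes> a) ` I" using I(2) assms(2) by force
  fix x y assume "x \<in> (\<lambda>x. x \<otimes> a) ` I" "y \<in> (\<lambda>x. x \<otimes> a) ` I"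
  then obtain b c where "b \<in> I" "c \<in> I" "x = b \<otimes> a" "y = c \<otimes> a" by auto
  then show "x \<oplus> y \<in> (\<lambda>x. x \<otimes> a) ` I"
    using I(3,4) assms(2) by (intro image_eqI[of _ _ "b \<oplus> c"]) (auto simp: l_distr)
next
  note I = left_idealD[OF assms(1)]
  fix r x assume "r \<in> carrier R" "x \<in> (\<lambda>x. x \<otimes> a) ` I"
  then obtain b where "b \<in> I" "x = b \<otimes> a" by auto
  then show "r \<otimes> x \<in> (\<lambda>x. x \<otimes> a) ` I"
    using I(3,7) assms(2) \<open>r \<in> carrier R\<close>
    by (intro image_eqI[of _ _ "r \<otimes> b"]) (auto simp: m_assoc)
qed

lemma left_ideal_carrier: "left_ideal (carrier R) R"
  by (rule left_idealI) auto

lemmas left_ideal_principal = left_ideal_right_mult[OF left_ideal_carrier]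

lemma mem_principal: "x \<in> carrier R \<Longrightarrow> x \<in> (\<lambda>r. r \<otimes> x) ` carrier R"
  by (rule image_eqI[of _ _ "\<one>"]) auto

lemma add_minus_cancel_left: "x \<in> carrier R \<Longrightarrow> y \<in> carrier R \<Longrightarrow> (x \<oplus> y) \<ominus> x = y"
  by (simp add: a_minus_def a_comm[of x y] a_assoc r_neg)

lemma lann_mult_mono:
  "x \<in> carrier R \<Longrightarrow> y \<in> carrier R \<Longrightarrow> lann R {x} \<subseteq> lann R {x \<otimes> y}"
  by (auto simp: lann_singleton simp flip: m_assoc)

lemma left_ideal_add:
  assumes "left_ideal I R" "left_ideal J R"
  shows "left_ideal {x \<oplus> y | x y. x \<in> I \<and> y \<in> J} R"
proof (rule left_idealI)
  note I = left_idealD[OF assms(1)] and J = left_idealD[OF assms(2)]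
  show "{x \<oplus> y | x y. x \<in> I \<and> y \<in> J} \<subseteq> carrier R" using I(3) J(3) by auto
  show "\<zero> \<in> {x \<oplus> y | x y. x \<in> I \<and> y \<in> J}" using I(2) J(2) by force
  fix u v assume "u \<in> {x \<oplus> y | x y. x \<in> I \<and> y \<in> J}" "v \<in> {x \<oplus> y | x y. x \<in> I \<and> y \<in> J}"
  then obtain x y x' y' where "x \<in> I" "y \<in> J" "x' \<in> I" "y' \<in> J" "u = x \<oplus> y" "v = x' \<oplus> y'"
    by auto
  moreover from this have "u \<oplus> v = (x \<oplus> x') \<oplus> (y \<oplus> y')"
    using I(3) J(3) by (simp add: a_ac)
  ultimately show "u \<oplus> v \<in> {x \<oplus> y | x y. x \<in> I \<and> y \<in> J}" using I(4) J(4) by blast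
next
  note I = left_idealD[OF assms(1)] and J = left_idealD[OF assms(2)]
  fix r u assume r: "r \<in> carrier R" and "u \<in> {x \<oplus> y | x y. x \<in> I \<and> y \<in> J}"
  then obtain x y where "x \<in> I" "y \<in> J" "u = x \<oplus> y" by auto
  moreover from this have "r \<otimes> u = r \<otimes> x \<oplus> r \<otimes> y"
    using I(3) J(3) r by (simp add: r_distr)
  ultimately show "r \<otimes> u \<in> {x \<oplus> y | x y. x \<in> I \<and> y \<in> J}" using I(7) J(7) r by blast
qed

lemma essential_left_ideal_iff:
  "essential_left_ideal E R \<longleftrightarrow> left_ideal E R \<and> essential_in R E (carrier R)"
proof (intro iffI conjI)
  assume E: "essential_left_ideal E R"
  then show "left_ideal E R" by (simp add: essential_left_ideal_def)
  show "essential_in R E (carrier R)"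
    unfolding essential_in_def
  proof (intro ballI impI)
    fix x assume x: "x \<in> carrier R" "x \<noteq> \<zero>"
    let ?J = "(\<lambda>r. r \<otimes> x) ` carrier R"
    have "x \<in> ?J" using x(1) by (rule mem_principal)
    then have "E \<inter> ?J \<noteq> {\<zero>}"
      using E left_ideal_principal[OF x(1)] x unfolding essential_left_ideal_def by blast
    moreover have "\<zero> \<in> E \<inter> ?J"
      using left_idealD(2)[OF \<open>left_ideal E R\<close>] left_idealD(2)[OF left_ideal_principal[OF x(1)]]
      by simp
    ultimately show "\<exists>r\<in>carrier R. r \<otimes> x \<in> E \<and> r \<otimes> x \<noteq> \<zero>" by blast
  qed
next
  assume "left_ideal E R \<and> essential_in R E (carrier R)"
  then have E: "left_ideal E R" "essential_in R E (carrier R)" by auto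
  show "essential_left_ideal E R"
    unfolding essential_left_ideal_def
  proof (intro conjI allI impI E)
    fix J assume J: "left_ideal J R \<and> J \<noteq> {\<zero>}"
    then obtain x where x: "x \<in> J" "x \<noteq> \<zero>" using left_idealD(2) by blast
    moreover have "x \<in> carrier R" using J x left_idealD by blast
    ultimately obtain r where "r \<in> carrier R" "r \<otimes> x \<in> E" "r \<otimes> x \<noteq> \<zero>"
      using E(2) unfolding essential_in_def by blast
    moreover have "r \<otimes> x \<in> J" using J x left_idealD(7) calculation by blast
    ultimately show "E \<inter> J \<noteq> {\<zero>}" by blast
  qed
qed

end

section \<open>Nonsingularity\<close>

definition left_nonsingular :: "('a, 'b) ring_scheme \<Rightarrow> bool" where
  "left_nonsingular R \<longleftrightarrow>
     (\<forall>x\<in>carrier R. essential_left_ideal (lann R {x}) R \<longrightarrow> x = \<zero>\<^bsub>R\<^esub>)"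

context ring
begin

text \<open>
  The left ideal \<open>{e. e x \<in> L}\<close> is the preimage of \<open>L\<close> under right multiplication by \<open>x\<close>.  It is
  essential when \<open>L\<close> is essential over \<open>R x\<close>, hence cannot annihilate \<open>y \<noteq> 0\<close>.
\<close>

lemma nonsingular_multiplier:
  assumes ns: "left_nonsingular R" and L: "left_ideal L R"
    and x: "x \<in> carrier R" and ess: "essential_in R L ((\<lambda>r. r \<otimes> x) ` carrier R)"
    and y: "y \<in> carrier R" "y \<noteq> \<zero>"
  obtains e where "e \<in> carrier R" "e \<otimes> x \<in> L" "e \<otimes> y \<noteq> \<zero>"
proof (rule ccontr)
  note witness = that
  assume no: "\<not> thesis"
  have kill: "e \<otimes> y = \<zero>" if "e \<in> carrier R" "e \<otimes> x \<in> L" for e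
    using no witness that by blast
  have "essential_in R (lann R {y}) (carrier R)"
    unfolding essential_in_def
  proof (intro ballI impI)
    fix k assume k: "k \<in> carrier R" "k \<noteq> \<zero>"
    show "\<exists>r\<in>carrier R. r \<otimes> k \<in> lann R {y} \<and> r \<otimes> k \<noteq> \<zero>"
    proof (cases "k \<otimes> x = \<zero>")
      case True
      then have "k \<otimes> y = \<zero>" using kill[OF k(1)] left_idealD(2)[OF L] by simp
      then show ?thesis using k by (intro bexI[of _ "\<one>"]) (auto simp: lann_singleton)
    next
      case False
      then obtain r where r: "r \<in> carrier R" "r \<otimes> (k \<otimes> x) \<in> L" "r \<otimes> (k \<otimes> x) \<noteq> \<zero>"
        using ess k(1) unfolding essential_in_def by blast
      then have "(r \<otimes> k) \<otimes> x \<in> L" "(r \<otimes> k) \<otimes> x \<noteq> \<zero>" using k x by (auto simp: m_assoc)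
      then have "(r \<otimes> k) \<otimes> y = \<zero>" "r \<otimes> k \<noteq> \<zero>" using kill[of "r \<otimes> k"] r k x by auto
      then show ?thesis using r(1) k(1) by (auto simp: lann_singleton)
    qed
  qed
  then have "essential_left_ideal (lann R {y}) R"
    using left_ideal_lann[of "{y}"] y by (simp add: essential_left_ideal_iff)
  then show False using ns y by (auto simp: left_nonsingular_def)
qed

end

section \<open>Finite Goldie dimension as a rank on left ideals\<close>

text \<open>
  For uniform \<open>U\<^sub>i\<close> whose sum is direct and essential, this is a dimension of \<open>L\<close>: a left ideal
  \<open>T\<close> that is disjoint from \<open>L\<close> and contains as many of the \<open>U\<^sub>i\<close> as possible plays the part of a
  complement of \<open>L\<close>, and the rank counts the summands that \<open>T\<close> leaves out.
\<close>

definition goldie_rank :: "('a, 'b) ring_scheme \<Rightarrow> nat \<Rightarrow> (nat \<Rightarrow> 'a set) \<Rightarrow> 'a set \<Rightarrow> nat" where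
  "goldie_rank R n U L =
     (LEAST k. \<exists>T. left_ideal T R \<and> L \<inter> T = {\<zero>\<^bsub>R\<^esub>} \<and> k = card {i. i < n \<and> \<not> U i \<subseteq> T})"

context ring
begin

lemma essential_in_uniform:
  assumes U: "uniform_left_ideal U R" and M: "left_ideal M R" and "M \<inter> U \<noteq> {\<zero>}"
  shows "essential_in R M U"
  unfolding essential_in_def
proof (intro ballI impI)
  fix x assume x: "x \<in> U" "x \<noteq> \<zero>"
  have lU: "left_ideal U R" using U by (simp add: uniform_left_ideal_def)
  note lU' = left_idealD[OF lU] and M' = left_idealD[OF M]
  let ?J = "\<lambda>z. (\<lambda>r. r \<otimes> z) ` carrier R"
  obtain y where y: "y \<in> M" "y \<in> U" "y \<noteq> \<zero>" using assms(3) lU'(2) M'(2) by blast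
  have J: "left_ideal (?J z) R" "?J z \<subseteq> U" "?J z \<noteq> {\<zero>}" if "z \<in> U" "z \<noteq> \<zero>" for z
  proof -
    show "left_ideal (?J z) R" using left_ideal_principal lU'(3) that by blast
    show "?J z \<subseteq> U" using lU'(7) that by blast
    have "z \<in> ?J z" using lU'(3) that by (intro mem_principal)
    then show "?J z \<noteq> {\<zero>}" using that by blast
  qed
  have "?J x \<inter> ?J y \<noteq> {\<zero>}"
    using U J[OF x] J[OF y(2,3)] unfolding uniform_left_ideal_def by blast
  moreover have "\<zero> \<in> ?J x \<inter> ?J y"
    using J(1)[OF x] J(1)[OF y(2,3)] left_idealD(2) by blast
  ultimately obtain z where z: "z \<in> ?J x" "z \<in> ?J y" "z \<noteq> \<zero>" by blast
  then obtain r s where rs: "r \<in> carrier R" "z = r \<otimes> x" "s \<in> carrier R" "z = s \<otimes> y" by auto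
  have "z \<in> M" using M'(7)[OF rs(3) y(1)] rs(4) by simp
  then show "\<exists>r\<in>carrier R. r \<otimes> x \<in> M \<and> r \<otimes> x \<noteq> \<zero>" using rs(1,2) z(3) by blast
qed

text \<open>
  Given \<open>z \<noteq> 0\<close>, move it into the direct sum of the \<open>U\<^sub>i\<close> and then multiply its components one
  after the other into \<open>M\<close>.  A multiplier is chosen so that the component being treated stays
  nonzero, and none is needed for a component that has already vanished.  So some component is nonzero
  at every stage, and by directness the final multiple of \<open>z\<close> is nonzero.
\<close>

lemma essential_if_meets_uniforms:
  assumes U: "\<forall>i<n. uniform_left_ideal (U i) R" and ind: "independent_left_ideals R n U"
    and ess: "essential_left_ideal (left_ideal_sum R n U) R"
    and M: "left_ideal M R" and meets: "\<forall>i<n. M \<inter> U i \<noteq> {\<zero>}"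
  shows "essential_in R M (carrier R)"
  unfolding essential_in_def
proof (intro ballI impI)
  note M' = left_idealD[OF M]
  fix z assume z: "z \<in> carrier R" "z \<noteq> \<zero>"
  then obtain q where q: "q \<in> carrier R" "q \<otimes> z \<in> left_ideal_sum R n U" "q \<otimes> z \<noteq> \<zero>"
    using ess unfolding essential_left_ideal_iff essential_in_def by blast
  then obtain u where u: "u \<in> (\<Pi> i\<in>{..<n}. U i)" "q \<otimes> z = finsum R u {..<n}"
    unfolding left_ideal_sum_def by blast
  have lU: "left_ideal (U i) R" if "i < n" for i
    using U that by (auto simp: uniform_left_ideal_def)
  have uU: "u i \<in> U i" "u i \<in> carrier R" if "i < n" for i
  proof -
    show "u i \<in> U i" using u(1) that by (simp add: Pi_iff)
    then show "u i \<in> carrier R" using left_idealD(3)[OF lU[OF that]] by blast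
  qed
  have "\<exists>r\<in>carrier R. (\<forall>i<k. r \<otimes> u i \<in> M) \<and> (\<exists>i<n. r \<otimes> u i \<noteq> \<zero>)" if "k \<le> n" for k
    using that
  proof (induction k)
    case 0
    have "\<exists>i<n. u i \<noteq> \<zero>"
    proof (rule ccontr)
      assume "\<not> (\<exists>i<n. u i \<noteq> \<zero>)"
      then have "finsum R u {..<n} = \<zero>" by (intro add.finprod_one_eqI) auto
      then show False using q u by simp
    qed
    then show ?case using uU by (intro bexI[of _ "\<one>"]) auto
  next
    case (Suc k)
    then obtain r where r: "r \<in> carrier R" "\<forall>i<k. r \<otimes> u i \<in> M" "\<exists>i<n. r \<otimes> u i \<noteq> \<zero>"
      by auto
    show ?case
    proof (cases "r \<otimes> u k = \<zero>")
      case True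
      then show ?thesis using r M'(2) by (metis less_Suc_eq)
    next
      case False
      have kn: "k < n" using Suc by simp
      have "essential_in R M (U k)"
        using essential_in_uniform[OF _ M] U meets kn by blast
      moreover have "r \<otimes> u k \<in> U k" using left_idealD(7)[OF lU[OF kn]] uU(1)[OF kn] r(1) by blast
      ultimately obtain s where s: "s \<in> carrier R" "s \<otimes> (r \<otimes> u k) \<in> M" "s \<otimes> (r \<otimes> u k) \<noteq> \<zero>"
        using False unfolding essential_in_def by blast
      have sr: "(s \<otimes> r) \<otimes> u i = s \<otimes> (r \<otimes> u i)" if "i < n" for i
        using s r uU(2)[OF that] by (simp add: m_assoc)
      have "(s \<otimes> r) \<otimes> u i \<in> M" if "i < Suc k" for i
        using that kn sr s r M'(7) by (metis less_Suc_eq less_trans)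
      moreover have "(s \<otimes> r) \<otimes> u k \<noteq> \<zero>" using sr[OF kn] s by simp
      ultimately show ?thesis using s(1) r(1) kn by blast
    qed
  qed
  then obtain r where r: "r \<in> carrier R" "\<forall>i<n. r \<otimes> u i \<in> M" "\<exists>i<n. r \<otimes> u i \<noteq> \<zero>"
    by blast
  have eq: "(r \<otimes> q) \<otimes> z = finsum R (\<lambda>i. r \<otimes> u i) {..<n}"
    using r(1) q(1) z(1) u(2) uU(2)
    by (simp add: m_assoc finsum_rdistr Pi_iff)
  have "finsum R (\<lambda>i. r \<otimes> u i) {..<k} \<in> M" if "k \<le> n" for k
    using that
  proof (induction k)
    case 0
    then show ?case using M'(2) by simp
  next
    case (Suc k)
    have "finsum R (\<lambda>i. r \<otimes> u i) {..<Suc k} = r \<otimes> u k \<oplus> finsum R (\<lambda>i. r \<otimes> u i) {..<k}"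
      unfolding lessThan_Suc using Suc.prems r(1) uU(2)
      by (subst finsum_insert) (auto simp: Pi_iff)
    then show ?case using Suc r(2) M'(4) by simp
  qed
  then have "(r \<otimes> q) \<otimes> z \<in> M" using eq by simp
  moreover have "(r \<otimes> q) \<otimes> z \<noteq> \<zero>"
  proof
    assume "(r \<otimes> q) \<otimes> z = \<zero>"
    moreover have "(\<lambda>i. r \<otimes> u i) \<in> (\<Pi> i\<in>{..<n}. U i)"
      using left_idealD(7)[OF lU] uU(1) r(1) by (auto simp: Pi_iff)
    ultimately show False
      using ind r(3) eq unfolding independent_left_ideals_def by metis
  qed
  ultimately show "\<exists>r\<in>carrier R. r \<otimes> z \<in> M \<and> r \<otimes> z \<noteq> \<zero>"
    using r(1) q(1) by blast
qed

lemma goldie_rank_le: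
  assumes "left_ideal T R" "L \<inter> T = {\<zero>}"
  shows "goldie_rank R n U L \<le> card {i. i < n \<and> \<not> U i \<subseteq> T}"
  unfolding goldie_rank_def using assms by (intro Least_le) blast

lemma goldie_rank_witness:
  assumes "left_ideal L R"
  obtains T where "left_ideal T R" "L \<inter> T = {\<zero>}"
    "goldie_rank R n U L = card {i. i < n \<and> \<not> U i \<subseteq> T}"
proof -
  have "L \<inter> {\<zero>} = {\<zero>}" using left_idealD(2)[OF assms] by blast
  then have "\<exists>k T. left_ideal T R \<and> L \<inter> T = {\<zero>} \<and> k = card {i. i < n \<and> \<not> U i \<subseteq> T}"
    using left_ideal_zero by blast
  from LeastI_ex[OF this] show ?thesis
    unfolding goldie_rank_def[symmetric] using that by blast
qed

text \<open>
  This is the exchange argument.  Let \<open>T\<close> be disjoint from \<open>M\<close> and realise the rank of \<open>M\<close>, and let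
  \<open>R x \<subseteq> M\<close> miss \<open>L\<close>.  Then \<open>R x\<close> also misses \<open>L + T\<close>, which is therefore not essential and so
  misses some \<open>U\<^sub>i\<close>.  Consequently \<open>T + U\<^sub>i\<close> is disjoint from \<open>L\<close>, and it leaves out fewer summands
  than \<open>T\<close>.
\<close>

lemma goldie_rank_less:
  assumes U: "\<forall>i<n. uniform_left_ideal (U i) R" and ind: "independent_left_ideals R n U"
    and ess: "essential_left_ideal (left_ideal_sum R n U) R"
    and L: "left_ideal L R" and M: "left_ideal M R" and "L \<subseteq> M"
    and "\<not> essential_in R L M"
  shows "goldie_rank R n U L < goldie_rank R n U M"
proof -
  obtain T where T: "left_ideal T R" "M \<inter> T = {\<zero>}"
    and rank: "goldie_rank R n U M = card {i. i < n \<and> \<not> U i \<subseteq> T}"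
    using goldie_rank_witness[OF M] by blast
  note L' = left_idealD[OF L] and M' = left_idealD[OF M] and T' = left_idealD[OF T(1)]
  obtain x where x: "x \<in> M" "x \<noteq> \<zero>" and xL: "\<And>r. r \<in> carrier R \<Longrightarrow> r \<otimes> x \<in> L \<Longrightarrow> r \<otimes> x = \<zero>"
    using assms(7) unfolding essential_in_def by blast
  let ?S = "{l \<oplus> t | l t. l \<in> L \<and> t \<in> T}"
  have S: "left_ideal ?S R" using left_ideal_add[OF L T(1)] .
  have "\<not> essential_in R ?S (carrier R)"
  proof
    assume "essential_in R ?S (carrier R)"
    then obtain r where r: "r \<in> carrier R" "r \<otimes> x \<in> ?S" "r \<otimes> x \<noteq> \<zero>"
      using x M'(3) unfolding essential_in_def by blast
    then obtain l t where lt: "l \<in> L" "t \<in> T" "r \<otimes> x = l \<oplus> t" by blast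
    have t: "t = (r \<otimes> x) \<ominus> l"
      using L'(3)[OF lt(1)] T'(3)[OF lt(2)] lt(3) by (simp add: add_minus_cancel_left)
    have "r \<otimes> x \<in> M" using r(1) x(1) by (rule M'(7))
    moreover have "l \<in> M" using lt(1) assms(6) by blast
    ultimately have "t \<in> M" unfolding t by (rule M'(6))
    then have "t = \<zero>" using lt T by blast
    then have "r \<otimes> x \<in> L" using lt L'(3) by simp
    then show False using xL r by blast
  qed
  then obtain i where i: "i < n" "?S \<inter> U i = {\<zero>}"
    using essential_if_meets_uniforms[OF U ind ess S] by blast
  have lUi: "left_ideal (U i) R" and Ui0: "U i \<noteq> {\<zero>}"
    using U i by (auto simp: uniform_left_ideal_def)
  note Ui = left_idealD[OF lUi]
  have TS: "T \<subseteq> ?S"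
  proof
    fix t assume "t \<in> T"
    then show "t \<in> ?S" using L'(2) T'(3) by (intro CollectI exI[of _ "\<zero>"] exI[of _ t]) auto
  qed
  let ?T = "{t \<oplus> u | t u. t \<in> T \<and> u \<in> U i}"
  have "left_ideal ?T R" using left_ideal_add[OF T(1) lUi] .
  moreover have "L \<inter> ?T = {\<zero>}"
  proof
    show "L \<inter> ?T \<subseteq> {\<zero>}"
    proof
      fix l assume "l \<in> L \<inter> ?T"
      then obtain t u where l: "l \<in> L" "t \<in> T" "u \<in> U i" "l = t \<oplus> u" by blast
      then have "u = l \<oplus> \<ominus> t"
        using T'(3)[OF l(2)] Ui(3)[OF l(3)] add_minus_cancel_left[of t u] by (simp add: a_minus_def)
      then have "u \<in> ?S" using l T'(5) by blast
      then have "u = \<zero>" using i l by blast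
      then have "l = t" using l T'(3) by simp
      then show "l \<in> {\<zero>}" using l T assms(6) by blast
    qed
    show "{\<zero>} \<subseteq> L \<inter> ?T"
      using left_idealD(2)[OF \<open>left_ideal ?T R\<close>] L'(2) by blast
  qed
  ultimately have le: "goldie_rank R n U L \<le> card {j. j < n \<and> \<not> U j \<subseteq> ?T}"
    by (rule goldie_rank_le)
  have "T \<subseteq> ?T"
  proof
    fix t assume "t \<in> T"
    then show "t \<in> ?T" using Ui(2) T'(3) by (intro CollectI exI[of _ t] exI[of _ "\<zero>"]) auto
  qed
  moreover have "U i \<subseteq> ?T"
  proof
    fix u assume "u \<in> U i"
    then show "u \<in> ?T" using T'(2) Ui(3) by (intro CollectI exI[of _ "\<zero>"] exI[of _ u]) auto
  qed
  moreover have "\<not> U i \<subseteq> T" using i(2) TS Ui0 Ui(2) by blast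
  ultimately have "{j. j < n \<and> \<not> U j \<subseteq> ?T} \<subset> {j. j < n \<and> \<not> U j \<subseteq> T}"
    using i(1) by blast
  then have "card {j. j < n \<and> \<not> U j \<subseteq> ?T} < card {j. j < n \<and> \<not> U j \<subseteq> T}"
    by (intro psubset_card_mono) auto
  then show ?thesis using le rank by simp
qed

lemma finite_goldie_dim_rank:
  assumes "finite_left_goldie_dim R"
  obtains \<rho> :: "'a set \<Rightarrow> nat" and n where
    "\<And>L. left_ideal L R \<Longrightarrow> \<rho> L \<le> n"
    "\<And>L M. left_ideal L R \<Longrightarrow> left_ideal M R \<Longrightarrow> L \<subseteq> M \<Longrightarrow> \<not> essential_in R L M \<Longrightarrow> \<rho> L < \<rho> M"
proof -
  obtain n U where U: "\<forall>i<n. uniform_left_ideal (U i) R" "independent_left_ideals R n U"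
    "essential_left_ideal (left_ideal_sum R n U) R"
    using assms unfolding finite_left_goldie_dim_def has_left_goldie_dim_def by blast
  have "goldie_rank R n U L \<le> n" if L: "left_ideal L R" for L
  proof -
    obtain T where "goldie_rank R n U L = card {i. i < n \<and> \<not> U i \<subseteq> T}"
      using goldie_rank_witness[OF L] by metis
    also have "\<dots> \<le> card {..<n}" by (intro card_mono) auto
    finally show ?thesis by simp
  qed
  then show ?thesis using that goldie_rank_less[OF U] by blast
qed

section \<open>From fusibility to the chain condition\<close>

text \<open>
  If \<open>lann x\<close> is essential then so is \<open>lann (s x)\<close>, being its preimage under right multiplication by
  \<open>s\<close>.  For \<open>s x = c + w\<close> it contains a nonzero multiple of an element of \<open>lann c\<close>; this multiple
  annihilates both \<open>s x\<close> and \<open>c\<close>, hence \<open>w\<close>.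
\<close>

lemma nonsingular_if_regular_left_fusible:
  assumes rlf: "regular_left_fusible R"
  shows "left_nonsingular R"
  unfolding left_nonsingular_def
proof (intro ballI impI, rule ccontr)
  fix x assume x: "x \<in> carrier R" "essential_left_ideal (lann R {x}) R" "x \<noteq> \<zero>"
  then obtain s where s: "regular_element R s" "left_fusible_element R (s \<otimes> x)"
    using rlf unfolding regular_left_fusible_def by blast
  have sc: "s \<in> carrier R" using s(1) by (simp add: regular_element_def left_regular_def)
  obtain c w where cw: "left_zero_divisor R c" "left_regular R w" "s \<otimes> x = c \<oplus> w"
    using s(2) unfolding left_fusible_element_def by blast
  have c: "c \<in> carrier R" and w: "w \<in> carrier R"
    using cw by (auto simp: left_zero_divisor_def left_regular_def)
  have "\<zero> \<in> lann R {c}" using c by (simp add: lann_singleton)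
  then obtain k where k: "k \<in> carrier R" "k \<otimes> c = \<zero>" "k \<noteq> \<zero>"
    using cw(1) unfolding left_zero_divisor_def lann_singleton by blast
  have "\<exists>r\<in>carrier R. r \<otimes> k \<noteq> \<zero> \<and> (r \<otimes> k) \<otimes> (s \<otimes> x) = \<zero>"
  proof (cases "k \<otimes> s = \<zero>")
    case True
    then have "k \<otimes> (s \<otimes> x) = \<zero>" using k x sc by (simp flip: m_assoc)
    then show ?thesis using k by (intro bexI[of _ "\<one>"]) auto
  next
    case False
    then obtain r where r: "r \<in> carrier R" "r \<otimes> (k \<otimes> s) \<in> lann R {x}" "r \<otimes> (k \<otimes> s) \<noteq> \<zero>"
      using x(2) k(1) sc unfolding essential_left_ideal_iff essential_in_def by blast
    then have "(r \<otimes> k) \<otimes> (s \<otimes> x) = \<zero>" using k(1) sc x(1) by (simp add: lann_singleton m_assoc)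
    moreover have "r \<otimes> k \<noteq> \<zero>"
    proof
      assume "r \<otimes> k = \<zero>"
      then have "r \<otimes> (k \<otimes> s) = \<zero>" using r(1) k(1) sc by (simp flip: m_assoc)
      then show False using r(3) by simp
    qed
    ultimately show ?thesis using r(1) by blast
  qed
  then obtain r where r: "r \<in> carrier R" "r \<otimes> k \<noteq> \<zero>" "(r \<otimes> k) \<otimes> (s \<otimes> x) = \<zero>" by blast
  have "(r \<otimes> k) \<otimes> c = \<zero>" using r(1) k c by (simp add: m_assoc)
  then have "(r \<otimes> k) \<otimes> w = \<zero>" using r k(1) c w cw(3) by (simp add: r_distr)
  then have "r \<otimes> k \<in> lann R {w}" using r(1) k(1) by (simp add: lann_singleton)
  then show False
    using cw(2) r(2) unfolding left_regular_def left_zero_divisor_def by blast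
qed

text \<open>
  A left annihilator \<open>lann A\<close> has no proper essential extension: if \<open>x\<close> lies in one, an
  essential left ideal multiplies \<open>x\<close> into \<open>lann A\<close>, so it annihilates \<open>x A\<close>, and
  nonsingularity gives \<open>x A = 0\<close>.  Hence every proper step of a chain raises the bounded rank.
\<close>

lemma acc_left_annihilators_if_nonsingular:
  assumes ns: "left_nonsingular R" and dim: "finite_left_goldie_dim R"
  shows "acc_left_annihilators R"
  unfolding acc_left_annihilators_def
proof (intro allI impI)
  fix L :: "nat \<Rightarrow> 'a set"
  assume chain: "\<forall>k. L k \<in> left_annihilators R \<and> L k \<subseteq> L (Suc k)"
  obtain \<rho> :: "'a set \<Rightarrow> nat" and n where bound: "\<And>L. left_ideal L R \<Longrightarrow> \<rho> L \<le> n"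
    and less: "\<And>L M. left_ideal L R \<Longrightarrow> left_ideal M R \<Longrightarrow> L \<subseteq> M \<Longrightarrow> \<not> essential_in R L M \<Longrightarrow> \<rho> L < \<rho> M"
    using finite_goldie_dim_rank[OF dim] by metis
  have ann: "\<exists>A. A \<subseteq> carrier R \<and> L k = lann R A" for k
    using chain unfolding left_annihilators_def by blast
  then have LI: "left_ideal (L k) R" for k using left_ideal_lann by metis
  have mono: "mono L" using chain by (simp add: mono_iff_le_Suc)
  have eq: "L k = L m" if "k \<le> m" and "essential_in R (L k) (L m)" for k m
  proof
    show "L k \<subseteq> L m" using mono that by (simp add: monoD)
    show "L m \<subseteq> L k"
    proof
      fix x assume x: "x \<in> L m"
      note Lm = left_idealD[OF LI[of m]]
      have xc: "x \<in> carrier R" using x Lm(3) by blast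
      obtain A where A: "A \<subseteq> carrier R" "L k = lann R A" using ann by blast
      have essx: "essential_in R (L k) ((\<lambda>r. r \<otimes> x) ` carrier R)"
        using that(2) Lm(7) x unfolding essential_in_def by blast
      have "x \<otimes> a = \<zero>" if a: "a \<in> A" for a
      proof (rule ccontr)
        have ac: "a \<in> carrier R" using a A by blast
        assume "x \<otimes> a \<noteq> \<zero>"
        then obtain e where e: "e \<in> carrier R" "e \<otimes> x \<in> L k" "e \<otimes> (x \<otimes> a) \<noteq> \<zero>"
          using nonsingular_multiplier[OF ns LI xc essx, of "x \<otimes> a"] xc ac by auto
        have "(e \<otimes> x) \<otimes> a = \<zero>" using e(2) A(2) a by (auto simp: lann_def)
        then show False using e xc ac by (simp add: m_assoc)
      qed
      then show "x \<in> L k" using xc A(2) by (simp add: lann_def)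
    qed
  qed
  have "\<exists>N. \<forall>k. \<rho> (L k) \<le> \<rho> (L N)"
    using ex_has_greatest_nat[of "\<lambda>_. True" 0 "\<lambda>k. \<rho> (L k)" "Suc n"] bound[OF LI]
    by (auto simp: less_Suc_eq_le)
  then obtain N where N: "\<And>k. \<rho> (L k) \<le> \<rho> (L N)" by blast
  have "L k = L N" if "k \<ge> N" for k
  proof -
    have "essential_in R (L N) (L k)"
      using less[OF LI LI monoD[OF mono that]] N[of k] by (meson leD)
    then show ?thesis using eq[OF that] by simp
  qed
  then show "\<exists>N. \<forall>k\<ge>N. L k = L N" by blast
qed

section \<open>Semiprime rings with chain condition on left annihilators\<close>

text \<open>
  If \<open>a R a = 0\<close>, the two-sided ideals \<open>D = {x. a R x = 0}\<close> and \<open>C = {y. y R D = 0}\<close> both contain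
  \<open>a\<close>, and \<open>C D = 0\<close>.  So \<open>C \<inter> D\<close> is an ideal of square zero that contains \<open>a\<close>.
\<close>

lemma semiprime_element:
  assumes sp: "semiprime_ring R" and a: "a \<in> carrier R"
    and aRa: "\<And>t. t \<in> carrier R \<Longrightarrow> a \<otimes> t \<otimes> a = \<zero>"
  shows "a = \<zero>"
proof -
  define D where "D = {x \<in> carrier R. \<forall>t\<in>carrier R. a \<otimes> t \<otimes> x = \<zero>}"
  define C where "C = {y \<in> carrier R. \<forall>t\<in>carrier R. \<forall>x\<in>D. y \<otimes> t \<otimes> x = \<zero>}"
  have Dc: "x \<in> carrier R" if "x \<in> D" for x using that by (simp add: D_def)
  have D: "ideal D R"
  proof (rule idealI)
    show "ring R" by (rule ring_axioms)
    show "subgroup D (add_monoid R)"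
      using a by (intro add.subgroupI) (auto simp: D_def r_distr r_minus simp flip: a_inv_def)
    fix x b assume x: "x \<in> D" and b: "b \<in> carrier R"
    then have xc: "x \<in> carrier R" by (simp add: D_def)
    have "a \<otimes> t \<otimes> (b \<otimes> x) = \<zero>" if "t \<in> carrier R" for t
    proof -
      have "a \<otimes> t \<otimes> (b \<otimes> x) = a \<otimes> (t \<otimes> b) \<otimes> x" using that a b xc by (simp add: m_assoc)
      then show ?thesis using x that b by (simp add: D_def)
    qed
    then show "b \<otimes> x \<in> D" using b xc by (simp add: D_def)
    have "a \<otimes> t \<otimes> (x \<otimes> b) = \<zero>" if "t \<in> carrier R" for t
    proof -
      have "a \<otimes> t \<otimes> (x \<otimes> b) = a \<otimes> t \<otimes> x \<otimes> b" using that a b xc by (simp add: m_assoc)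
      then show ?thesis using x that b by (simp add: D_def)
    qed
    then show "x \<otimes> b \<in> D" using b xc by (simp add: D_def)
  qed
  have C: "ideal C R"
  proof (rule idealI)
    show "ring R" by (rule ring_axioms)
    show "subgroup C (add_monoid R)"
      by (intro add.subgroupI) (auto simp: C_def l_distr l_minus Dc simp flip: a_inv_def)
    fix y b assume y: "y \<in> C" and b: "b \<in> carrier R"
    then have yc: "y \<in> carrier R" by (simp add: C_def)
    have "b \<otimes> y \<otimes> t \<otimes> x = \<zero>" "y \<otimes> b \<otimes> t \<otimes> x = \<zero>" if "t \<in> carrier R" "x \<in> D" for t x
    proof -
      have "b \<otimes> y \<otimes> t \<otimes> x = b \<otimes> (y \<otimes> t \<otimes> x)" using that Dc b yc by (simp add: m_assoc)
      then show "b \<otimes> y \<otimes> t \<otimes> x = \<zero>" using y that b by (simp add: C_def)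
      have "y \<otimes> b \<otimes> t \<otimes> x = y \<otimes> (b \<otimes> t) \<otimes> x" using that Dc b yc by (simp add: m_assoc)
      then show "y \<otimes> b \<otimes> t \<otimes> x = \<zero>" using y that b by (simp add: C_def)
    qed
    then show "b \<otimes> y \<in> C" "y \<otimes> b \<in> C" using b yc by (auto simp: C_def)
  qed
  have I: "ideal (C \<inter> D) R" using i_intersect[OF C D] .
  have prod0: "x \<otimes> y = \<zero>" if "x \<in> C" "y \<in> D" for x y
  proof -
    have "x \<otimes> \<one> \<otimes> y = \<zero>" using that unfolding C_def by blast
    then show ?thesis using that(1) by (simp add: C_def)
  qed
  have "x = \<zero>" if "x \<in> ideal_prod R (C \<inter> D) (C \<inter> D)" for x
    using that by (induction rule: ideal_prod.induct) (auto simp: prod0)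
  moreover have "\<zero> \<in> ideal_prod R (C \<inter> D) (C \<inter> D)"
    using additive_subgroup.zero_closed[OF ideal.axioms(1)[OF ideal_prod_is_ideal[OF I I]]] .
  ultimately have "ideal_prod R (C \<inter> D) (C \<inter> D) = {\<zero>}" by blast
  then have "C \<inter> D = {\<zero>}" using sp I unfolding semiprime_ring_def by blast
  moreover have "a \<in> C \<inter> D" using a aRa by (auto simp: C_def D_def)
  ultimately show ?thesis by blast
qed

lemma acc_maximal_lann:
  assumes acc: "acc_left_annihilators R" and "P \<subseteq> carrier R" "P \<noteq> {}"
  obtains x where "x \<in> P" "\<And>y. y \<in> P \<Longrightarrow> lann R {x} \<subseteq> lann R {y} \<Longrightarrow> lann R {y} = lann R {x}"
proof (rule ccontr)
  note witness = that
  assume no: "\<not> thesis"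
  have step: "\<exists>y. y \<in> P \<and> lann R {x} \<subset> lann R {y}" if "x \<in> P" for x
    using no witness[OF that] by blast
  have "\<exists>f. \<forall>k. f k \<in> P \<and> lann R {f k} \<subset> lann R {f (Suc k)}"
    using assms(3) step by (intro dependent_nat_choice) auto
  then obtain f where f: "\<And>k. f k \<in> P" "\<And>k. lann R {f k} \<subset> lann R {f (Suc k)}" by blast
  have "lann R {f k} \<in> left_annihilators R" for k
    using f(1)[of k] assms(2) by (auto simp: left_annihilators_def)
  moreover have "lann R {f k} \<subseteq> lann R {f (Suc k)}" for k
    using f(2)[of k] by (rule psubset_imp_subset)
  ultimately obtain N where N: "\<And>k. k \<ge> N \<Longrightarrow> lann R {f k} = lann R {f N}"
    using acc[unfolded acc_left_annihilators_def, rule_format, of "\<lambda>k. lann R {f k}"] by blast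
  have "lann R {f (Suc N)} = lann R {f N}" by (rule N) simp
  then show False using f(2)[of N] by simp
qed

text \<open>
  Among the nonzero elements with essential left annihilator take \<open>a\<close> with \<open>lann a\<close> maximal.  If
  \<open>a t a \<noteq> 0\<close>, then \<open>R a t\<close> meets \<open>lann a\<close>, so some \<open>r\<close> with \<open>r a \<noteq> 0\<close> annihilates \<open>a t a\<close>, and
  \<open>lann (a t a)\<close> is strictly larger than \<open>lann a\<close>, against maximality.  Hence \<open>a R a = 0\<close>, against
  semiprimeness.
\<close>

lemma nonsingular_if_semiprime_acc:
  assumes sp: "semiprime_ring R" and acc: "acc_left_annihilators R"
  shows "left_nonsingular R"
proof (rule ccontr)
  define Z where "Z = {z \<in> carrier R. z \<noteq> \<zero> \<and> essential_in R (lann R {z}) (carrier R)}"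
  assume "\<not> left_nonsingular R"
  then have "Z \<noteq> {}" unfolding left_nonsingular_def Z_def essential_left_ideal_iff by blast
  moreover have "Z \<subseteq> carrier R" by (auto simp: Z_def)
  ultimately obtain a where aZ: "a \<in> Z"
    and max: "\<And>y. y \<in> Z \<Longrightarrow> lann R {a} \<subseteq> lann R {y} \<Longrightarrow> lann R {y} = lann R {a}"
    using acc_maximal_lann[OF acc] by metis
  have a: "a \<in> carrier R" "a \<noteq> \<zero>" "essential_in R (lann R {a}) (carrier R)"
    using aZ by (auto simp: Z_def)
  have "a \<otimes> t \<otimes> a = \<zero>" if t: "t \<in> carrier R" for t
  proof (rule ccontr)
    assume nz: "a \<otimes> t \<otimes> a \<noteq> \<zero>"
    have sub: "lann R {a} \<subseteq> lann R {a \<otimes> t \<otimes> a}"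
      using lann_mult_mono[of a "t \<otimes> a"] a(1) t by (simp add: m_assoc)
    then have "a \<otimes> t \<otimes> a \<in> Z"
      using a(1,3) t nz unfolding Z_def essential_in_def by blast
    then have eq: "lann R {a \<otimes> t \<otimes> a} = lann R {a}" using max sub by blast
    have "a \<otimes> t \<noteq> \<zero>" using nz a by auto
    then obtain r where r: "r \<in> carrier R" "r \<otimes> (a \<otimes> t) \<in> lann R {a}" "r \<otimes> (a \<otimes> t) \<noteq> \<zero>"
      using a t unfolding essential_in_def by blast
    then have "r \<otimes> (a \<otimes> t \<otimes> a) = \<zero>" using a t by (simp add: lann_singleton m_assoc)
    then have "r \<otimes> a = \<zero>" using eq r(1) by (auto simp: lann_singleton)
    then have "r \<otimes> (a \<otimes> t) = \<zero>" using r(1) a t by (simp flip: m_assoc)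
    then show False using r(3) by simp
  qed
  then show False using semiprime_element[OF sp a(1)] a(2) by blast
qed

text \<open>
  Take \<open>p = v u \<noteq> 0\<close> with \<open>lann p\<close> maximal among the nonzero products in \<open>V N\<close>, and \<open>t\<close> with
  \<open>p t p \<noteq> 0\<close>.  Since \<open>p t p\<close> is again such a product, \<open>lann (p t p) = lann p\<close>: trailing factors
  \<open>t p\<close> may be cancelled as long as a factor \<open>p\<close> precedes them.  Replacing \<open>v\<close> by \<open>t p t v\<close> turns the
  product into \<open>t p t p\<close>.  The prefix \<open>t\<close> makes cancellation apply to its square, and the
  factor \<open>p t\<close> traps \<open>lann (t p t v)\<close> between \<open>lann (t p)\<close> and \<open>lann (t p t p)\<close>, which are equal.
\<close>

lemma product_with_stable_lann:
  assumes sp: "semiprime_ring R" and acc: "acc_left_annihilators R"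
    and V: "left_ideal V R" and N: "left_ideal N R"
    and nz: "v0 \<in> V" "u0 \<in> N" "v0 \<otimes> u0 \<noteq> \<zero>"
  obtains v u where "v \<in> V" "u \<in> N" "v \<otimes> u \<noteq> \<zero>"
    "\<And>x. x \<in> carrier R \<Longrightarrow> x \<otimes> (v \<otimes> u) = \<zero> \<Longrightarrow> x \<otimes> v = \<zero>"
    "\<And>x. x \<in> carrier R \<Longrightarrow> x \<otimes> (v \<otimes> u) \<otimes> (v \<otimes> u) = \<zero> \<Longrightarrow> x \<otimes> (v \<otimes> u) = \<zero>"
proof -
  note V' = left_idealD[OF V] and N' = left_idealD[OF N]
  define P where "P = {p. p \<noteq> \<zero> \<and> (\<exists>v\<in>V. \<exists>u\<in>N. p = v \<otimes> u)}"
  have "P \<subseteq> carrier R" using V'(3) N'(3) by (auto simp: P_def)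
  moreover have "P \<noteq> {}" using nz by (auto simp: P_def)
  ultimately obtain p where pP: "p \<in> P"
    and max: "\<And>q. q \<in> P \<Longrightarrow> lann R {p} \<subseteq> lann R {q} \<Longrightarrow> lann R {q} = lann R {p}"
    using acc_maximal_lann[OF acc] by metis
  then obtain v u where vu: "v \<in> V" "u \<in> N" "p = v \<otimes> u" "p \<noteq> \<zero>" by (auto simp: P_def)
  have c: "v \<in> carrier R" "u \<in> carrier R" "p \<in> carrier R" using vu V'(3) N'(3) by auto
  obtain t where t: "t \<in> carrier R" "p \<otimes> t \<otimes> p \<noteq> \<zero>"
    using semiprime_element[OF sp c(3)] vu(4) by blast
  have ptp: "lann R {p \<otimes> t \<otimes> p} = lann R {p}"
  proof (rule max)
    have "p \<otimes> t \<otimes> p = (p \<otimes> t \<otimes> v) \<otimes> u" using c t(1) by (simp add: vu(3) m_assoc)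
    moreover have "p \<otimes> t \<otimes> v \<in> V" using V'(7) vu(1) c t(1) by simp
    ultimately show "p \<otimes> t \<otimes> p \<in> P" using t(2) vu(2) unfolding P_def by blast
    show "lann R {p} \<subseteq> lann R {p \<otimes> t \<otimes> p}"
      using lann_mult_mono[of p "t \<otimes> p"] c t(1) by (simp add: m_assoc)
  qed
  have cancel: "x \<otimes> p = \<zero>" if "x \<in> carrier R" "x \<otimes> p \<otimes> t \<otimes> p = \<zero>" for x
  proof -
    have "x \<in> lann R {p \<otimes> t \<otimes> p}" using that c t(1) by (simp add: lann_singleton m_assoc)
    then show ?thesis unfolding ptp by (simp add: lann_singleton)
  qed
  let ?v = "t \<otimes> p \<otimes> t \<otimes> v"
  have a: "?v \<otimes> u = t \<otimes> p \<otimes> t \<otimes> p" using c t(1) by (simp add: vu(3) m_assoc)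
  show thesis
  proof (rule that)
    show "?v \<in> V" using V'(7) vu(1) c t(1) by simp
    show "u \<in> N" by (rule vu(2))
    show "?v \<otimes> u \<noteq> \<zero>"
    proof
      assume "?v \<otimes> u = \<zero>"
      then have "t \<otimes> p = \<zero>" using cancel[of t] t(1) a by simp
      then show False using t c by (simp add: m_assoc)
    qed
    fix x assume x: "x \<in> carrier R"
    have xt: "x \<otimes> t \<otimes> p = \<zero>" if "x \<otimes> (?v \<otimes> u) = \<zero>"
    proof -
      have "(x \<otimes> t) \<otimes> p \<otimes> t \<otimes> p = \<zero>" using that unfolding a using x c t(1) by (simp add: m_assoc)
      then show ?thesis using cancel x t(1) by simp
    qed
    show "x \<otimes> ?v = \<zero>" if "x \<otimes> (?v \<otimes> u) = \<zero>"
    proof -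
      have "x \<otimes> ?v = (x \<otimes> t \<otimes> p) \<otimes> (t \<otimes> v)" using x c t(1) by (simp add: m_assoc)
      then show ?thesis using xt[OF that] c t(1) by simp
    qed
    show "x \<otimes> (?v \<otimes> u) = \<zero>" if "x \<otimes> (?v \<otimes> u) \<otimes> (?v \<otimes> u) = \<zero>"
    proof -
      have "(x \<otimes> t \<otimes> p \<otimes> t \<otimes> p \<otimes> t) \<otimes> p \<otimes> t \<otimes> p = \<zero>"
        using that unfolding a using x c t(1) by (simp add: m_assoc)
      then have "(x \<otimes> t \<otimes> p \<otimes> t \<otimes> p \<otimes> t) \<otimes> p = \<zero>" using cancel x c t(1) by simp
      then have "(x \<otimes> t \<otimes> p \<otimes> t) \<otimes> p = \<zero>" using cancel x c t(1) by simp
      then show ?thesis unfolding a using x c t(1) by (simp add: m_assoc)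
    qed
  qed
qed

text \<open>
  Write \<open>N = lann w\<close>, let \<open>C\<close> be the left annihilator of \<open>N\<close> and \<open>B \<supseteq> N\<close> the right annihilator of
  \<open>C\<close>.  Both are two-sided and \<open>B \<inter> C = 0\<close> by semiprimeness, so any nonzero \<open>v \<in> B\<close> satisfies
  \<open>v N \<noteq> 0\<close>; it remains to find one whose multiples avoid \<open>R w\<close>.  Otherwise \<open>R w\<close> would be essential
  over \<open>B\<close>.  By nonsingularity right multiplication preserves essential inclusions, so each
  \<open>R w\<^sup>n\<close> would be essential over \<open>B\<close> and would meet \<open>N\<close>.  But the chain \<open>lann w\<^sup>n\<close> stops growing, and
  then \<open>x w\<^sup>n \<in> N\<close>, that is \<open>x w\<^sup>n w = 0\<close>, forces \<open>x w\<^sup>n = 0\<close>.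
\<close>

lemma principal_misses_right_multiples:
  assumes sp: "semiprime_ring R" and acc: "acc_left_annihilators R"
    and w: "w \<in> carrier R" and k: "k \<in> lann R {w}" "k \<noteq> \<zero>"
  obtains v u where "v \<in> carrier R" "u \<in> lann R {w}" "v \<otimes> u \<noteq> \<zero>"
    "\<And>r x. r \<in> carrier R \<Longrightarrow> x \<in> carrier R \<Longrightarrow> r \<otimes> v = x \<otimes> w \<Longrightarrow> r \<otimes> v = \<zero>"
proof -
  have ns: "left_nonsingular R" using nonsingular_if_semiprime_acc[OF sp acc] .
  let ?N = "lann R {w}"
  have N: "left_ideal ?N R" using left_ideal_lann[of "{w}"] w by simp
  note N' = left_idealD[OF N]
  define C where "C = {x \<in> carrier R. \<forall>u\<in>?N. x \<otimes> u = \<zero>}"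
  define B where "B = {y \<in> carrier R. \<forall>c\<in>C. c \<otimes> y = \<zero>}"
  have Cc: "c \<in> carrier R" if "c \<in> C" for c using that by (simp add: C_def)
  have Bc: "b \<in> carrier R" if "b \<in> B" for b using that by (simp add: B_def)
  have Cr: "c \<otimes> t \<in> C" if "c \<in> C" "t \<in> carrier R" for c t
    using that N'(3,7) by (auto simp: C_def m_assoc)
  have Bl: "t \<otimes> b \<in> B" if "b \<in> B" "t \<in> carrier R" for b t
  proof -
    have "c \<otimes> (t \<otimes> b) = \<zero>" if "c \<in> C" for c
    proof -
      have "(c \<otimes> t) \<otimes> b = \<zero>" using Cr[OF that \<open>t \<in> carrier R\<close>] \<open>b \<in> B\<close> by (simp add: B_def)
      then show ?thesis using Cc[OF that] Bc[OF \<open>b \<in> B\<close>] \<open>t \<in> carrier R\<close> by (simp add: m_assoc)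
    qed
    moreover have "t \<otimes> b \<in> carrier R" using that(2) Bc[OF that(1)] by simp
    ultimately show ?thesis unfolding B_def by blast
  qed
  have Br: "b \<otimes> t \<in> B" if "b \<in> B" "t \<in> carrier R" for b t
    using that Cc by (auto simp: B_def simp flip: m_assoc)
  have CB: "x = \<zero>" if "x \<in> C" "x \<in> B" for x
  proof (rule semiprime_element[OF sp Cc[OF that(1)]])
    fix t assume "t \<in> carrier R"
    then show "x \<otimes> t \<otimes> x = \<zero>" using Cr[OF that(1)] that(2) by (simp add: B_def)
  qed
  have BB: "\<exists>b\<in>B. b \<otimes> y \<noteq> \<zero>" if "y \<in> B" "y \<noteq> \<zero>" for y
    using semiprime_element[OF sp Bc[OF that(1)]] that Br by blast
  have kB: "k \<in> B" using k(1) N'(3) by (auto simp: B_def C_def)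
  have "\<not> essential_in R ((\<lambda>x. x \<otimes> w) ` carrier R) B"
  proof
    assume ess: "essential_in R ((\<lambda>x. x \<otimes> w) ` carrier R) B"
    have pow: "essential_in R ((\<lambda>x. x \<otimes> w [^] n) ` carrier R) B" for n :: nat
    proof (induction n)
      case 0
      then show ?case unfolding essential_in_def
        using Bc by (intro ballI impI bexI[of _ "\<one>"]) (auto simp: image_iff)
    next
      case (Suc n)
      show ?case unfolding essential_in_def
      proof (intro ballI impI)
        fix v assume v: "v \<in> B" "v \<noteq> \<zero>"
        then obtain r x where r: "r \<in> carrier R" "x \<in> carrier R" "r \<otimes> v = x \<otimes> w" "r \<otimes> v \<noteq> \<zero>"
          using ess unfolding essential_in_def by blast
        \<comment> \<open>The cofactor \<open>x\<close> may lie outside \<open>B\<close>, where nothing is known about \<open>R w\<^sup>n\<close>; \<open>b x\<close> lies inside.\<close>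
        obtain b where b: "b \<in> B" "b \<otimes> (r \<otimes> v) \<noteq> \<zero>" using BB Bl v r by blast
        have bx: "b \<otimes> x \<in> B" using Br b r by blast
        note c = Bc[OF b(1)] Bc[OF v(1)] Bc[OF bx] r(1,2) w
        have bxw: "(b \<otimes> x) \<otimes> w = b \<otimes> (r \<otimes> v)" using c r(3) by (simp add: m_assoc)
        have "essential_in R ((\<lambda>x. x \<otimes> w [^] n) ` carrier R) ((\<lambda>r. r \<otimes> (b \<otimes> x)) ` carrier R)"
          using Suc Bl[OF bx] unfolding essential_in_def by blast
        then obtain e where e: "e \<in> carrier R" "e \<otimes> (b \<otimes> x) \<in> (\<lambda>x. x \<otimes> w [^] n) ` carrier R"
          "e \<otimes> ((b \<otimes> x) \<otimes> w) \<noteq> \<zero>"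
          using nonsingular_multiplier[OF ns left_ideal_principal, of "w [^] n" "b \<otimes> x" "b \<otimes> x \<otimes> w"]
            c bxw b(2) by (metis m_closed nat_pow_closed)
        then obtain z where z: "z \<in> carrier R" "e \<otimes> (b \<otimes> x) = z \<otimes> w [^] n" by blast
        have "e \<otimes> ((b \<otimes> x) \<otimes> w) = (e \<otimes> (b \<otimes> x)) \<otimes> w" using e(1) c by (simp add: m_assoc)
        also have "\<dots> = z \<otimes> w [^] Suc n" using z w by (simp add: m_assoc)
        finally have "(e \<otimes> b \<otimes> r) \<otimes> v = z \<otimes> w [^] Suc n" "(e \<otimes> b \<otimes> r) \<otimes> v \<noteq> \<zero>"
          using e(1,3) c bxw by (simp_all add: m_assoc)
        then show "\<exists>r\<in>carrier R. r \<otimes> v \<in> (\<lambda>x. x \<otimes> w [^] Suc n) ` carrier R \<and> r \<otimes> v \<noteq> \<zero>"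
          using e(1) c z(1) by (intro bexI[of _ "e \<otimes> b \<otimes> r"]) auto
      qed
    qed
    obtain n :: nat where n: "lann R {w [^] Suc n} = lann R {w [^] n}"
    proof -
      have "range (\<lambda>n::nat. w [^] n) \<subseteq> carrier R" using w by auto
      then obtain p where p: "p \<in> range (\<lambda>n::nat. w [^] n)"
        and max: "\<And>q. q \<in> range (\<lambda>n::nat. w [^] n) \<Longrightarrow> lann R {p} \<subseteq> lann R {q} \<Longrightarrow> lann R {q} = lann R {p}"
        using acc_maximal_lann[OF acc, of "range (\<lambda>n::nat. w [^] n)"] by blast
      from p obtain n :: nat where n: "p = w [^] n" by blast
      have "lann R {w [^] n} \<subseteq> lann R {w [^] Suc n}"
        using w lann_mult_mono[of "w [^] n" w] by simp
      then show thesis using that max n by blast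
    qed
    obtain r z where r: "r \<in> carrier R" "z \<in> carrier R" "r \<otimes> k = z \<otimes> w [^] n" "r \<otimes> k \<noteq> \<zero>"
      using pow[of n] kB k(2) unfolding essential_in_def by blast
    have "r \<otimes> k \<in> ?N" using N'(7) k(1) r(1) by blast
    then have "(z \<otimes> w [^] n) \<otimes> w = \<zero>" using r(3) by (simp add: lann_singleton)
    then have "z \<in> lann R {w [^] Suc n}" using r(2) w by (simp add: lann_singleton m_assoc)
    then have "z \<otimes> w [^] n = \<zero>" unfolding n by (simp add: lann_singleton)
    then show False using r(3,4) by simp
  qed
  then obtain v where v: "v \<in> B" "v \<noteq> \<zero>"
    and miss: "\<And>r. r \<in> carrier R \<Longrightarrow> r \<otimes> v \<in> (\<lambda>x. x \<otimes> w) ` carrier R \<Longrightarrow> r \<otimes> v = \<zero>"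
    unfolding essential_in_def by blast
  have "v \<notin> C" using CB v by blast
  then obtain u where "u \<in> ?N" "v \<otimes> u \<noteq> \<zero>" using Bc[OF v(1)] by (auto simp: C_def)
  then show thesis using that Bc[OF v(1)] miss by blast
qed

section \<open>Decomposing elements of semiprime left Goldie rings\<close>

text \<open>
  If \<open>R j\<close> missed \<open>R l\<close> then, \<open>l\<close> being left regular, \<open>R j l\<^sup>k\<close> would miss \<open>R l\<^sup>k\<^sup>+\<^sup>1\<close> inside
  \<open>R l\<^sup>k\<close>, and the rank would drop forever along the powers of \<open>l\<close>.  So \<open>R l\<close> is essential, and since
  it annihilates \<open>r\<close>, nonsingularity gives \<open>r = 0\<close>.
\<close>

lemma right_regular_if_left_regular:
  assumes ns: "left_nonsingular R" and dim: "finite_left_goldie_dim R"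
    and l: "l \<in> carrier R" and reg: "\<And>x. x \<in> carrier R \<Longrightarrow> x \<otimes> l = \<zero> \<Longrightarrow> x = \<zero>"
    and r: "r \<in> carrier R" "l \<otimes> r = \<zero>"
  shows "r = \<zero>"
proof -
  obtain \<rho> :: "'a set \<Rightarrow> nat" where
    less: "\<And>L M. left_ideal L R \<Longrightarrow> left_ideal M R \<Longrightarrow> L \<subseteq> M \<Longrightarrow> \<not> essential_in R L M \<Longrightarrow> \<rho> L < \<rho> M"
    using finite_goldie_dim_rank[OF dim] by metis
  define P where "P k = (\<lambda>x. x \<otimes> l [^] k) ` carrier R" for k :: nat
  have P: "left_ideal (P k) R" for k unfolding P_def using left_ideal_principal l by simp
  have powreg: "x = \<zero>" if "x \<in> carrier R" "x \<otimes> l [^] k = \<zero>" for x and k :: nat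
    using that
  proof (induction k)
    case (Suc k)
    have "(x \<otimes> l [^] k) \<otimes> l = \<zero>" using Suc.prems l by (simp add: m_assoc)
    moreover have "x \<otimes> l [^] k \<in> carrier R" using Suc.prems(1) l by simp
    ultimately have "x \<otimes> l [^] k = \<zero>" using reg by blast
    with Suc.prems(1) show ?case by (rule Suc.IH)
  qed simp
  have "essential_in R ((\<lambda>x. x \<otimes> l) ` carrier R) (carrier R)"
  proof (rule ccontr)
    assume "\<not> essential_in R ((\<lambda>x. x \<otimes> l) ` carrier R) (carrier R)"
    then obtain j where j: "j \<in> carrier R" "j \<noteq> \<zero>"
      and miss: "\<And>r. r \<in> carrier R \<Longrightarrow> r \<otimes> j \<in> (\<lambda>x. x \<otimes> l) ` carrier R \<Longrightarrow> r \<otimes> j = \<zero>"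
      unfolding essential_in_def by blast
    have comm: "x \<otimes> l [^] Suc k = (x \<otimes> l) \<otimes> l [^] k" if "x \<in> carrier R" for x and k :: nat
      using that l nat_pow_Suc2[OF l, of k] by (simp add: m_assoc)
    have drop: "\<rho> (P (Suc k)) < \<rho> (P k)" for k
    proof (rule less[OF P P])
      show "P (Suc k) \<subseteq> P k"
        unfolding P_def using comm l by (auto simp del: nat_pow_Suc)
      show "\<not> essential_in R (P (Suc k)) (P k)"
      proof
        assume "essential_in R (P (Suc k)) (P k)"
        moreover have "j \<otimes> l [^] k \<in> P k" "j \<otimes> l [^] k \<noteq> \<zero>"
          using j powreg by (auto simp: P_def)
        ultimately obtain q z where q: "q \<in> carrier R" "z \<in> carrier R"
          "q \<otimes> (j \<otimes> l [^] k) = z \<otimes> l [^] Suc k" "q \<otimes> (j \<otimes> l [^] k) \<noteq> \<zero>"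
          unfolding essential_in_def P_def by blast
        have "(q \<otimes> j \<ominus> z \<otimes> l) \<otimes> l [^] k = \<zero>"
          using q j l comm[OF q(2), of k] by (simp add: a_minus_def l_distr l_minus m_assoc r_neg)
        then have "q \<otimes> j \<ominus> z \<otimes> l = \<zero>" using powreg q j l by simp
        then have "q \<otimes> j = z \<otimes> l" using q j l by simp
        then have "q \<otimes> j = \<zero>" using miss q by blast
        then have "q \<otimes> (j \<otimes> l [^] k) = \<zero>" using q(1) j l by (simp flip: m_assoc)
        then show False using q(4) by simp
      qed
    qed
    have "\<rho> (P k) + k \<le> \<rho> (P 0)" for k
    proof (induction k)
      case (Suc k)
      then show ?case using drop[of k] by simp
    qed simp
    from this[of "Suc (\<rho> (P 0))"] show False by simp
  qed
  then have ess: "essential_in R ((\<lambda>x. x \<otimes> l) ` carrier R) ((\<lambda>x. x \<otimes> \<one>) ` carrier R)" by simp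
  show ?thesis
  proof (rule ccontr)
    assume "r \<noteq> \<zero>"
    then obtain e where e: "e \<in> carrier R" "e \<otimes> \<one> \<in> (\<lambda>x. x \<otimes> l) ` carrier R" "e \<otimes> r \<noteq> \<zero>"
      using nonsingular_multiplier[OF ns left_ideal_principal[OF l] one_closed ess r(1)] by blast
    then obtain z where "z \<in> carrier R" "e = z \<otimes> l" by auto
    then have "e \<otimes> r = \<zero>" using l r by (simp add: m_assoc)
    then show False using e(3) by simp
  qed
qed

text \<open>
  The induction described at the start, run as a minimal choice: among the admissible pairs \<open>(l, w)\<close>
  take one for which \<open>lann w\<close> has least rank.
\<close>

lemma left_fusible_if_semiprime_goldie:
  assumes sp: "semiprime_ring R" and acc: "acc_left_annihilators R"
    and dim: "finite_left_goldie_dim R" and r: "r \<in> carrier R" "r \<noteq> \<zero>"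
  shows "left_fusible_element R r"
proof -
  obtain \<rho> :: "'a set \<Rightarrow> nat" where
    less: "\<And>L M. left_ideal L R \<Longrightarrow> left_ideal M R \<Longrightarrow> L \<subseteq> M \<Longrightarrow> \<not> essential_in R L M \<Longrightarrow> \<rho> L < \<rho> M"
    using finite_goldie_dim_rank[OF dim] by metis
  \<comment> \<open>Besides the conditions that the conclusion uses, a pair keeps \<open>lann l\<^sup>2 = lann l\<close> and
    \<open>lann w \<subseteq> lann l \<inter> lann r\<close>.  The inclusion gives \<open>a l = a r = 0\<close> for each \<open>a \<in> lann w\<close>; with the
    equation this yields \<open>lann (l + a) = lann l \<inter> lann a\<close>.\<close>
  define S where "S l w \<longleftrightarrow> l \<in> carrier R \<and> w \<in> carrier R \<and> l \<otimes> r = \<zero> \<and>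
    (\<forall>x\<in>carrier R. x \<otimes> l \<otimes> l = \<zero> \<longrightarrow> x \<otimes> l = \<zero>) \<and>
    (\<forall>x\<in>carrier R. x \<otimes> l = \<zero> \<longrightarrow> x \<otimes> (r \<ominus> w) = \<zero>) \<and>
    (\<forall>x\<in>carrier R. x \<otimes> w = \<zero> \<longrightarrow> x \<otimes> l = \<zero> \<and> x \<otimes> r = \<zero>)" for l w
  have "S \<zero> r" using r by (auto simp: S_def r_neg a_minus_def)
  then obtain l w where S: "S l w"
    and min: "\<And>l' w'. S l' w' \<Longrightarrow> \<rho> (lann R {w}) \<le> \<rho> (lann R {w'})"
    using ex_has_least_nat[of "\<lambda>(l, w). S l w" "(\<zero>, r)" "\<lambda>(l, w). \<rho> (lann R {w})"] by auto
  have l: "l \<in> carrier R" "l \<otimes> r = \<zero>" and w: "w \<in> carrier R"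
    and ll: "\<And>x. x \<in> carrier R \<Longrightarrow> x \<otimes> l \<otimes> l = \<zero> \<Longrightarrow> x \<otimes> l = \<zero>"
    and lc: "\<And>x. x \<in> carrier R \<Longrightarrow> x \<otimes> l = \<zero> \<Longrightarrow> x \<otimes> (r \<ominus> w) = \<zero>"
    and wlr: "\<And>x. x \<in> carrier R \<Longrightarrow> x \<otimes> w = \<zero> \<Longrightarrow> x \<otimes> l = \<zero>"
      "\<And>x. x \<in> carrier R \<Longrightarrow> x \<otimes> w = \<zero> \<Longrightarrow> x \<otimes> r = \<zero>"
    using S unfolding S_def by blast+
  have N: "left_ideal (lann R {w}) R" using left_ideal_lann[of "{w}"] w by simp
  have wreg: "lann R {w} = {\<zero>}"
  proof (rule ccontr)
    assume "lann R {w} \<noteq> {\<zero>}"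
    then obtain k where k: "k \<in> lann R {w}" "k \<noteq> \<zero>" using left_idealD(2)[OF N] by blast
    obtain v0 u0 where v0: "v0 \<in> carrier R" "u0 \<in> lann R {w}" "v0 \<otimes> u0 \<noteq> \<zero>"
      and miss0: "\<And>s x. s \<in> carrier R \<Longrightarrow> x \<in> carrier R \<Longrightarrow> s \<otimes> v0 = x \<otimes> w \<Longrightarrow> s \<otimes> v0 = \<zero>"
      using principal_misses_right_multiples[OF sp acc w k] by metis
    obtain v u where v: "v \<in> (\<lambda>s. s \<otimes> v0) ` carrier R" and u: "u \<in> lann R {w}"
      and nz: "v \<otimes> u \<noteq> \<zero>"
      and av: "\<And>x. x \<in> carrier R \<Longrightarrow> x \<otimes> (v \<otimes> u) = \<zero> \<Longrightarrow> x \<otimes> v = \<zero>"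
      and aa: "\<And>x. x \<in> carrier R \<Longrightarrow> x \<otimes> (v \<otimes> u) \<otimes> (v \<otimes> u) = \<zero> \<Longrightarrow> x \<otimes> (v \<otimes> u) = \<zero>"
      using product_with_stable_lann[OF sp acc left_ideal_principal[OF v0(1)] N mem_principal[OF v0(1)] v0(2,3)]
      by metis
    define a where "a = v \<otimes> u"
    have vc: "v \<in> carrier R" using v v0(1) by auto
    have uc: "u \<in> carrier R" using u by (simp add: lann_singleton)
    have ac: "a \<in> carrier R" using vc uc by (simp add: a_def)
    have aN: "a \<in> lann R {w}" using left_idealD(7)[OF N vc u] by (simp add: a_def)
    then have al: "a \<otimes> l = \<zero>" and ar: "a \<otimes> r = \<zero>" and aw: "a \<otimes> w = \<zero>"
      using wlr by (auto simp: lann_singleton)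
    have miss: "x \<otimes> v = \<zero>" if x: "x \<in> carrier R" "y \<in> carrier R" "x \<otimes> v = y \<otimes> w" for x y
    proof -
      obtain s where "s \<in> carrier R" "v = s \<otimes> v0" using v by blast
      then show ?thesis using miss0[of "x \<otimes> s" y] x v0(1) by (simp add: m_assoc)
    qed
    have la: "x \<otimes> l = \<zero> \<and> x \<otimes> a = \<zero>" if x: "x \<in> carrier R" "x \<otimes> (l \<oplus> a) = \<zero>" for x
    proof -
      have "x \<otimes> l \<otimes> l = x \<otimes> (l \<oplus> a) \<otimes> l"
        using x(1) l ac al by (simp add: r_distr l_distr m_assoc)
      then have "x \<otimes> l = \<zero>" using ll x l by simp
      then show ?thesis using x l ac by (simp add: r_distr)
    qed
    have wv: "x \<otimes> w = \<zero> \<and> x \<otimes> a = \<zero>" if x: "x \<in> carrier R" "x \<otimes> (w \<oplus> v) = \<zero>" for x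
    proof -
      have sum: "x \<otimes> w \<oplus> x \<otimes> v = \<zero>" using x w vc by (simp add: r_distr)
      then have "x \<otimes> v = (\<ominus> x) \<otimes> w"
        using x(1) w vc by (simp add: l_minus) (metis a_comm m_closed minus_equality minus_minus)
      then have xv: "x \<otimes> v = \<zero>" using miss x(1) by blast
      then have "x \<otimes> a = \<zero>" using x(1) vc uc by (simp add: a_def flip: m_assoc)
      then show ?thesis using sum xv x(1) w by simp
    qed
    \<comment> \<open>The new pair is admissible because \<open>lann (w + v) = lann w \<inter> lann a\<close>, which holds since \<open>R v\<close>
      avoids \<open>R w\<close> and \<open>lann v = lann a\<close>.\<close>
    have "S (l \<oplus> a) (w \<oplus> v)"
      unfolding S_def
    proof (intro conjI ballI impI)
      show "l \<oplus> a \<in> carrier R" "w \<oplus> v \<in> carrier R" using l ac w vc by auto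
      show "(l \<oplus> a) \<otimes> r = \<zero>" using l ar ac r by (simp add: l_distr)
      fix x assume x: "x \<in> carrier R"
      show "x \<otimes> (l \<oplus> a) = \<zero>" if "x \<otimes> (l \<oplus> a) \<otimes> (l \<oplus> a) = \<zero>"
      proof -
        have y: "x \<otimes> (l \<oplus> a) \<otimes> l = \<zero>" "x \<otimes> (l \<oplus> a) \<otimes> a = \<zero>" using la[OF _ that] x l ac by auto
        then have "x \<otimes> l \<otimes> l = \<zero>" using x l ac al by (simp add: r_distr l_distr m_assoc)
        then have xl: "x \<otimes> l = \<zero>" using ll x by simp
        then have "x \<otimes> a \<otimes> a = \<zero>" using y(2) x l ac by (simp add: r_distr)
        then have "x \<otimes> a = \<zero>" using aa x by (simp add: a_def)
        then show ?thesis using xl x l ac by (simp add: r_distr)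
      qed
      show "x \<otimes> (r \<ominus> (w \<oplus> v)) = \<zero>" if "x \<otimes> (l \<oplus> a) = \<zero>"
      proof -
        have "x \<otimes> (r \<ominus> w) = \<zero>" "x \<otimes> v = \<zero>"
          using la[OF x that] lc av x by (auto simp: a_def)
        moreover have "r \<ominus> (w \<oplus> v) = (r \<ominus> w) \<ominus> v"
          using r w vc by (simp add: a_minus_def minus_add a_assoc)
        ultimately show ?thesis using x r w vc by (simp add: a_minus_def r_distr r_minus)
      qed
      show "x \<otimes> (l \<oplus> a) = \<zero>" "x \<otimes> r = \<zero>" if "x \<otimes> (w \<oplus> v) = \<zero>"
        using wv[OF x that] wlr x l ac by (auto simp: r_distr)
    qed
    moreover have "\<rho> (lann R {w \<oplus> v}) < \<rho> (lann R {w})"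
    proof (rule less[OF left_ideal_lann N])
      show "{w \<oplus> v} \<subseteq> carrier R" using w vc by simp
      show "lann R {w \<oplus> v} \<subseteq> lann R {w}" using wv by (auto simp: lann_singleton)
      show "\<not> essential_in R (lann R {w \<oplus> v}) (lann R {w})"
      proof
        assume "essential_in R (lann R {w \<oplus> v}) (lann R {w})"
        then obtain x where x: "x \<in> carrier R" "x \<otimes> a \<in> lann R {w \<oplus> v}" "x \<otimes> a \<noteq> \<zero>"
          using aN nz unfolding essential_in_def a_def by blast
        then have "x \<otimes> a \<otimes> a = \<zero>" using wv[of "x \<otimes> a"] ac by (simp add: lann_singleton)
        then show False using aa x(1,3) by (simp add: a_def)
      qed
    qed
    ultimately show False using min by (meson leD)
  qed
  have "left_zero_divisor R (r \<ominus> w)"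
    unfolding left_zero_divisor_def
  proof (intro conjI notI)
    show "r \<ominus> w \<in> carrier R" using r w by simp
    assume "lann R {r \<ominus> w} = {\<zero>}"
    then have "x = \<zero>" if "x \<in> carrier R" "x \<otimes> l = \<zero>" for x
      using lc[OF that] that(1) by (auto simp: lann_singleton)
    then have "r = \<zero>"
      using right_regular_if_left_regular[OF nonsingular_if_semiprime_acc[OF sp acc] dim l(1) _ r(1) l(2)]
      by blast
    then show False using r(2) by simp
  qed
  moreover have "left_regular R w"
    using wreg w by (simp add: left_regular_def left_zero_divisor_def)
  moreover have "r = (r \<ominus> w) \<oplus> w" using r w by (simp add: a_minus_def a_assoc l_neg)
  ultimately show ?thesis using r unfolding left_fusible_element_def by blast
qed

lemma regular_element_one: "regular_element R \<one>"
  by (auto simp: regular_element_def left_regular_def right_regular_def left_zero_divisor_def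
      lann_singleton)

end

theorem theorem2p14:
  fixes R :: "('a, 'b) ring_scheme" (structure)
  assumes "ring R" and "semiprime_ring R"
  shows "left_goldie R \<longleftrightarrow> regular_left_fusible R \<and> finite_left_goldie_dim R"
proof -
  interpret ring R by (rule assms(1))
  show ?thesis
  proof
    assume G: "left_goldie R"
    have "left_fusible_element R (\<one> \<otimes> r)" if "r \<in> carrier R" "r \<noteq> \<zero>" for r
      using left_fusible_if_semiprime_goldie[OF assms(2)] G that by (simp add: left_goldie_def)
    then have "regular_left_fusible R"
      using regular_element_one unfolding regular_left_fusible_def by blast
    then show "regular_left_fusible R \<and> finite_left_goldie_dim R"
      using G by (simp add: left_goldie_def)
  next
    assume "regular_left_fusible R \<and> finite_left_goldie_dim R"
    then show "left_goldie R"
      using acc_left_annihilators_if_nonsingular[OF nonsingular_if_regular_left_fusible]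
      by (simp add: left_goldie_def)
  qed
qed

end
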